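(* With parameter $r$, $$\int_0^\infty x\left(e^{-x^2/\pi}+r\,e^{-r^4 x^2/\pi}\right)\frac{\sinh rx}{\cosh^2 rx}\,dx=\int_0^\infty \frac{e^{-r^2 x^2/\pi}}{\cosh (r^2 x)}\,dx.$$
   Context: Here $r$ is a parameter for which no explicit range is specified; the identity generalizes one of Amdeberhan and Moll stated for $r=2$. Notation: $\sinh rx=\sinh(rx)$, $\cosh^2 rx=(\cosh(rx))^2$.
   Formalization: The parameter r is taken to be a positive real: at r = 0 the right-hand integral diverges, and for r < 0 the identity is false, since the first summand on the left changes sign while the right side is even in r. *)

theory Defs
  imports "HOL-Analysis.Analysis"
begin

end

theory Submission
  imports Defs "HOL-Complex_Analysis.Complex_Analysis" "HOL-Probability.Probability" "HOL-Real_Asymp.Real_Asymp"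
begin

text \<open>
  All integrands are even, so we integrate over the whole line.  Put
  $H(a) = \int (1 - 2ax^2) e^{-ax^2} \,\mathrm{sech}\, x\, dx$ and
  $K(a) = \int e^{-ax^2} \,\mathrm{sech}\, x\, dx$.
  As $(1 - 2cx^2) e^{-cx^2}$ is the derivative of $x e^{-cx^2}$, integration by parts and scaling turn the
  two summands of the left-hand side into $r^{-2} H(b)$ and $r^{-1} H(r^2/\pi)$ with $b = 1/(\pi r^2)$,
  while the right-hand side is $r^{-2} K(b)$.  The hyperbolic secant is, up to scaling, its own Fourier
  transform, and the cosine transform of $(1 - 2ax^2) e^{-ax^2}$ is a multiple of $w^2 e^{-w^2/(4a)}$, so
  Fubini's theorem gives $r H(r^2/\pi) = K(b) - H(b)$, which is the claim.
\<close>

section \<open>The complex hyperbolic cosine and a residue computation on a rectangle\<close>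

lemma norm_cosh_squared: "(norm (cosh z))\<^sup>2 = (sinh (Re z))\<^sup>2 + (cos (Im z))\<^sup>2" for z :: complex
  by (simp add: cosh_conv_cos norm_cos_squared sinh_field_def exp_minus power_divide flip: power2_eq_square)

lemma cosh_complex_of_real: "cosh (complex_of_real x) = of_real (cosh x)"
  by (simp add: cosh_field_def exp_of_real exp_minus)

lemma cosh_add_pi_i: "cosh (z + \<i> * of_real pi) = - cosh z" for z :: complex
  by (simp add: cosh_conv_cos distrib_left cos_diff cos_of_real sin_of_real mult.assoc[symmetric])

lemma holomorphic_on_cosh: "(cosh :: complex \<Rightarrow> complex) holomorphic_on A"
  unfolding holomorphic_on_def field_differentiable_def by (auto intro!: derivative_eq_intros)

lemma sech_rectangle_bound:
  fixes w R :: real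
  assumes w: "0 \<le> w" and R: "0 < R"
  shows "norm ((1 + exp (- pi * w)) * integral {-R..R} (\<lambda>x. exp (\<i> * w * x) / cosh (of_real x)) - 2 * pi * exp (- pi * w / 2))
    \<le> 2 * pi / sinh R"
proof -
  \<comment> \<open>The only pole in the rectangle \<open>[-R, R] \<times> [0, \<pi>]\<close> is \<open>\<i>\<pi>/2\<close>, and \<open>f (z + \<i>\<pi>) = - exp (- \<pi>w) * f z\<close>
    makes the upper side a multiple of the lower one.\<close>
  define f where "f = (\<lambda>z. exp (\<i> * w * z) / cosh z)"
  \<comment> \<open>The neighbouring zeros \<open>- \<i> * pi / 2\<close> and
    \<open>3 * \<i> * pi / 2\<close> of \<open>cosh\<close> lie on the edge of this open strip:
    \<open>p\<close> is the only zero inside, and the closed rectangle still fits.\<close>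
  define S where "S = {z. - (pi/2) < Im z \<and> Im z < 3 * pi / 2}"
  define p where "p = \<i> * (pi / 2)"
  have S_alt: "S = {z. - (pi/2) < Im z} \<inter> {z. Im z < 3 * pi / 2}"
    by (auto simp: S_def)
  have opS: "open S" unfolding S_alt
    by (intro open_Int open_halfspace_Im_gt open_halfspace_Im_lt)
  have connS: "connected S" unfolding S_alt
    by (intro convex_connected convex_Int convex_halfspace_Im_gt convex_halfspace_Im_lt)
  have pS: "p \<in> S" by (simp add: p_def S_def)
  have coshp: "cosh p = 0"
    using norm_cosh_squared[of p] by (simp add: p_def)
  have sinhp: "sinh p = \<i>"
    by (simp add: p_def sinh_conv_sin mult.assoc[symmetric])
  have "\<i> * w * p = of_real (- pi * w / 2)"
    by (simp add: p_def complex_eq_iff)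
  then have exp_p: "exp (\<i> * w * p) = of_real (exp (- pi * w / 2))"
    by (simp only: exp_of_real)
  have nz: "cosh z \<noteq> 0" if "z \<in> S" "z \<noteq> p" for z
  proof
    assume "cosh z = 0"
    with norm_cosh_squared[of z] have "(sinh (Re z))\<^sup>2 + (cos (Im z))\<^sup>2 = 0" by simp
    then have re: "Re z = 0" and c: "cos (Im z) = 0"
      by (auto simp: sum_power2_eq_zero_iff)
    \<comment> \<open>The shift turns the zero of the cosine into a zero of the sine in the open
      interval (-pi, pi), where 0 is the only one.\<close>
    have "sin (Im z - pi/2) = 0" using c by (simp add: sin_diff)
    moreover have "\<bar>Im z - pi/2\<bar> < pi" using that by (auto simp: S_def abs_if)
    ultimately have "Im z - pi/2 = 0"
      using sin_eq_0_pi[of "Im z - pi/2"] by (auto simp: abs_less_iff)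
    with re have "z = p" by (simp add: p_def complex_eq_iff)
    with that show False by simp
  qed
  have holo: "f holomorphic_on S - {p}"
    unfolding f_def using nz by (auto intro!: holomorphic_intros holomorphic_on_cosh)
  have res: "residue f p = exp (\<i> * w * p) / sinh p"
    unfolding f_def
    by (rule residue_simple_pole_deriv[OF _ _ opS connS pS])
       (auto intro!: holomorphic_intros holomorphic_on_cosh derivative_eq_intros simp: coshp sinhp)
  let ?a1 = "- complex_of_real R" and ?a2 = "complex_of_real R"
    and ?a3 = "complex_of_real R + \<i> * pi" and ?a4 = "- complex_of_real R + \<i> * pi"
  have im: "path_image (rectpath ?a1 ?a3) \<subseteq> S - {p}"
    using R pi_gt_zero by (auto simp: path_image_rectpath S_def p_def simp del: pi_gt_zero)
  have "contour_integral (rectpath ?a1 ?a3) f = 2 * pi * \<i> * (\<Sum>q\<in>{p}. winding_number (rectpath ?a1 ?a3) q * residue f q)"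
  proof (rule Residue_theorem[OF opS connS _ holo _ _ im])
    show "\<forall>z. z \<notin> S \<longrightarrow> winding_number (rectpath ?a1 ?a3) z = 0"
      using R pi_gt_zero
      by (auto intro!: winding_number_rectpath_outside simp: S_def in_cbox_complex_iff simp del: pi_gt_zero)
  qed auto
  also have "\<dots> = 2 * pi * \<i> * (winding_number (rectpath ?a1 ?a3) p * residue f p)"
    by (simp only: sum.insert finite.emptyI empty_iff not_False_eq_True sum.empty add_0_right)
  also have "winding_number (rectpath ?a1 ?a3) p = 1"
    using R by (intro winding_number_rectpath) (auto simp: in_box_complex_iff p_def)
  \<comment> \<open>The factor \<open>\<i>\<close> cancels against \<open>sinh p = \<i>\<close>, the
    derivative of \<open>cosh\<close> at the simple pole, so the value is real.\<close>
  also have "2 * pi * \<i> * (1 * residue f p) = complex_of_real (2 * pi * exp (- pi * w / 2))"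
  proof -
    have "2 * pi * \<i> * (1 * (complex_of_real e / \<i>)) = complex_of_real (2 * pi * e)" for e
      by (simp add: complex_eq_iff)
    then show ?thesis by (simp only: res sinhp exp_p)
  qed
  finally have total: "contour_integral (rectpath ?a1 ?a3) f = complex_of_real (2 * pi * exp (- pi * w / 2))" .
  have "rectpath ?a1 ?a3 = linepath ?a1 ?a2 +++ linepath ?a2 ?a3 +++ linepath ?a3 ?a4 +++ linepath ?a4 ?a1"
    by (simp add: rectpath_def Let_def Complex_eq)
  moreover
  have cont: "continuous_on (path_image (rectpath ?a1 ?a3)) f"
    using holomorphic_on_imp_continuous_on[OF holo] im continuous_on_subset by blast
  ultimately have cont_seg: "continuous_on (closed_segment ?a1 ?a2) f" "continuous_on (closed_segment ?a2 ?a3) f"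
     "continuous_on (closed_segment ?a3 ?a4) f" "continuous_on (closed_segment ?a4 ?a1) f"
    by (auto simp: path_image_join intro: continuous_on_subset)
  note ci = cont_seg[THEN contour_integrable_continuous_linepath]
  have split: "contour_integral (rectpath ?a1 ?a3) f = contour_integral (linepath ?a1 ?a2) f
     + contour_integral (linepath ?a2 ?a3) f + contour_integral (linepath ?a3 ?a4) f + contour_integral (linepath ?a4 ?a1) f"
    using ci by (simp add: \<open>rectpath _ _ = _\<close> add.assoc)
  let ?I = "integral {-R..R} (\<lambda>x. exp (\<i> * w * x) / cosh (of_real x))"
  have bot: "contour_integral (linepath ?a1 ?a2) f = ?I"
    using R by (subst contour_integral_linepath_Reals_eq) (auto simp: f_def)
  \<comment> \<open>Two minus signs cancel: one from reversing the upper side, one from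
    \<open>cosh_add_pi_i\<close>.\<close>
  have top: "contour_integral (linepath ?a3 ?a4) f = exp (- pi * w) * ?I"
  proof -
    have "contour_integral (linepath ?a3 ?a4) f = - contour_integral (linepath ?a4 ?a3) f"
      using cont_seg(3) by (rule contour_integral_reverse_linepath)
    also have "linepath ?a4 ?a3 = (+) (\<i> * pi) \<circ> linepath ?a1 ?a2"
      by (auto simp: linepath_def algebra_simps scaleR_conv_of_real)
    also have "contour_integral \<dots> f = contour_integral (linepath ?a1 ?a2) (\<lambda>z. f (z + \<i> * pi))"
      by (rule contour_integral_translate)
    also have "(\<lambda>z. f (z + \<i> * pi)) = (\<lambda>z. - exp (- pi * w) * f z)"
    proof
      fix z
      have "\<i> * w * (z + \<i> * pi) = of_real (- pi * w) + \<i> * w * z"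
        by (simp add: algebra_simps)
      then have "exp (\<i> * w * (z + \<i> * pi)) = of_real (exp (- pi * w)) * exp (\<i> * w * z)"
        by (simp only: exp_add exp_of_real)
      then show "f (z + \<i> * pi) = - exp (- pi * w) * f z"
        by (simp add: f_def cosh_add_pi_i)
    qed
    also have "contour_integral (linepath ?a1 ?a2) \<dots> = - exp (- pi * w) * contour_integral (linepath ?a1 ?a2) f"
      by (rule contour_integral_lmul[OF ci(1)])
    finally show ?thesis by (simp add: bot)
  qed
  \<comment> \<open>Dropping the squared cosine in \<open>norm_cosh_squared\<close> leaves
    \<open>sinh R\<close> as a lower bound for the denominator. The numerator has norm
    \<open>exp (- w * Im z)\<close>, at most 1 because \<open>w\<close> and \<open>Im z\<close> are
    nonnegative.\<close>
  have side: "norm (f z) \<le> 1 / sinh R" if "\<bar>Re z\<bar> = R" "0 \<le> Im z" for z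
  proof -
    have "(sinh R)\<^sup>2 = (sinh (Re z))\<^sup>2"
      using that(1) by (auto simp: abs_if split: if_splits)
    also have "\<dots> \<le> (norm (cosh z))\<^sup>2"
      by (simp add: norm_cosh_squared)
    finally have "sinh R \<le> norm (cosh z)"
      by (rule power2_le_imp_le) simp
    moreover have "norm (exp (\<i> * w * z)) \<le> 1"
      using w that by simp
    ultimately show ?thesis
      unfolding f_def norm_divide using R by (intro frac_le) auto
  qed
  have "norm (contour_integral (linepath ?a2 ?a3) f) \<le> (1 / sinh R) * norm (?a3 - ?a2)"
    using R by (intro contour_integral_bound_linepath ci side) (auto simp: closed_segment_same_Re closed_segment_eq_real_ivl split: if_splits)
  moreover have "norm (contour_integral (linepath ?a4 ?a1) f) \<le> (1 / sinh R) * norm (?a1 - ?a4)"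
    using R by (intro contour_integral_bound_linepath ci side) (auto simp: closed_segment_same_Re closed_segment_eq_real_ivl split: if_splits)
  \<comment> \<open>Each vertical side has length \<open>pi\<close>.\<close>
  ultimately have "norm (contour_integral (linepath ?a2 ?a3) f + contour_integral (linepath ?a4 ?a1) f) \<le> 2 * pi / sinh R"
    by (intro order.trans[OF norm_triangle_ineq]) (simp add: norm_mult)
  moreover have "(1 + exp (- pi * w)) * ?I - 2 * pi * exp (- pi * w / 2) =
     - (contour_integral (linepath ?a2 ?a3) f + contour_integral (linepath ?a4 ?a1) f)"
    using total unfolding split bot top by (simp add: algebra_simps)
  ultimately show ?thesis by (simp only: norm_minus_cancel)
qed

section \<open>Gaussian integrals over the line and their cosine transforms\<close>

text \<open>Serves as integration by parts on the whole line: taking for \<open>F\<close> the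
  boundary terms, the boundary contribution reduces to two limits.\<close>

lemma integral_lborel_derivative_eq_0:
  fixes F f :: "real \<Rightarrow> real"
  assumes "\<And>x. (F has_real_derivative f x) (at x)" "\<And>x. isCont f x" "integrable lborel f"
    and "(F \<longlongrightarrow> 0) at_top" "(F \<longlongrightarrow> 0) at_bot"
  shows "integral\<^sup>L lborel f = 0"
proof -
  have "(LBINT x=-\<infinity>..\<infinity>. f x) = 0 - 0"
    using assms
    by (intro interval_integral_FTC_integrable[where F=F])
       (auto simp: has_real_derivative_iff_has_vector_derivative ereal_tendsto_simps set_integrable_def)
  then show ?thesis
    by (simp add: interval_lebesgue_integral_def set_lebesgue_integral_def)
qed

lemma integrable_power_gaussian:
  fixes a :: real
  assumes "a > 0"
  shows "integrable lborel (\<lambda>x. x ^ k * exp (- (a * x\<^sup>2)))"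
proof -
  \<comment> \<open>The standard deviation for which the normal density has exponent - a x^2; the
    claim becomes integrability of a normal moment.\<close>
  define s where "s = 1 / sqrt (2 * a)"
  have s: "s > 0" "s\<^sup>2 = 1 / (2 * a)" using assms by (auto simp: s_def power_divide)
  have "(\<lambda>x. x ^ k * exp (- (a * x\<^sup>2))) = (\<lambda>x. sqrt (2 * pi * s\<^sup>2) * (normal_density 0 s x * (x - 0) ^ k))"
    using assms s(1) unfolding normal_density_def by (auto simp: s(2) fun_eq_iff mult_ac)
  then show ?thesis
    using integrable_normal_moment[OF s(1), of 0 k] by simp
qed

text \<open>Real part of the characteristic function of the standard normal distribution, rescaled
  by \<open>c = sqrt (2 * a)\<close> so that (c x)^2 / 2 becomes a x^2.\<close>

lemma integral_gaussian_cos: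
  fixes a w :: real
  assumes "a > 0"
  shows "(\<integral>x. exp (- (a * x\<^sup>2)) * cos (w * x) \<partial>lborel) = sqrt (pi / a) * exp (- (w\<^sup>2 / (4 * a)))"
proof -
  define c t where "c = sqrt (2 * a)" and "t = w / c"
  have c: "c > 0" "c\<^sup>2 = 2 * a" using assms by (auto simp: c_def)
  have "(\<integral>x. std_normal_density x * cos (t * x) \<partial>lborel) = (\<integral>x. cos (t * x) \<partial>std_normal_distribution)"
    by (subst integral_density) auto
  also have "\<dots> = (\<integral>x. Re (iexp (t * x)) \<partial>std_normal_distribution)"
    by (simp flip: cis_conv_exp of_real_mult)
  also have "\<dots> = Re (char std_normal_distribution t)"
    unfolding char_def
    by (intro integral_Re prob_space.integrable_iexp prob_space_normal_density) auto
  also have "\<dots> = exp (- (t\<^sup>2 / 2))"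
    by (simp add: char_std_normal_distribution)
  finally have "exp (- (t\<^sup>2 / 2)) = c * (\<integral>x. std_normal_density (c * x) * cos (t * (c * x)) \<partial>lborel)"
    using lborel_integral_real_affine[of c "\<lambda>x. std_normal_density x * cos (t * x)" 0] c by simp
  also have "(\<lambda>x. std_normal_density (c * x) * cos (t * (c * x))) = (\<lambda>x. (1 / sqrt (2 * pi)) * (exp (- (a * x\<^sup>2)) * cos (w * x)))"
    using c by (simp add: normal_density_def t_def power_mult_distrib)
  finally have "exp (- (t\<^sup>2 / 2)) = c / sqrt (2 * pi) * (\<integral>x. exp (- (a * x\<^sup>2)) * cos (w * x) \<partial>lborel)"
    by simp
  moreover have "t\<^sup>2 / 2 = w\<^sup>2 / (4 * a)" by (simp add: t_def power_divide c(2))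
  moreover have "sqrt (2 * pi) / c = sqrt (pi / a)" by (simp add: c_def flip: real_sqrt_divide)
  ultimately show ?thesis using c by (simp add: field_simps)
qed

lemma integrable_mult_bounded:
  fixes f g :: "real \<Rightarrow> real"
  assumes "integrable lborel f" "g \<in> borel_measurable borel" "\<And>x. \<bar>g x\<bar> \<le> 1"
  shows "integrable lborel (\<lambda>x. f x * g x)"
  using assms(2) by (intro Bochner_Integration.integrable_bound[OF assms(1)])
    (auto simp: abs_mult intro!: mult_left_le assms(3) borel_measurable_times borel_measurable_integrable[OF assms(1), simplified])

lemma gaussian_tendsto_0:
  fixes a :: real
  assumes "a > 0"
  shows "((\<lambda>x. exp (- (a * x\<^sup>2))) \<longlongrightarrow> 0) at_top" "((\<lambda>x. exp (- (a * x\<^sup>2))) \<longlongrightarrow> 0) at_bot"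
    "((\<lambda>x. x * exp (- (a * x\<^sup>2))) \<longlongrightarrow> 0) at_top" "((\<lambda>x. x * exp (- (a * x\<^sup>2))) \<longlongrightarrow> 0) at_bot"
  using assms by real_asymp+

lemma tendsto_0_mult_bounded:
  fixes f g :: "real \<Rightarrow> real"
  assumes "(f \<longlongrightarrow> 0) F" "\<And>x. \<bar>g x\<bar> \<le> 1"
  shows "((\<lambda>x. f x * g x) \<longlongrightarrow> 0) F"
  by (rule Lim_null_comparison[OF always_eventually tendsto_rabs_zero[OF assms(1)]])
     (auto simp: abs_mult intro!: mult_left_le assms(2))

lemma integrable_hermite_gaussian:
  fixes a :: real
  assumes "a > 0"
  shows "integrable lborel (\<lambda>x. (1 - 2 * a * x\<^sup>2) * exp (- (a * x\<^sup>2)))"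
  using integrable_power_gaussian[OF assms, of 0] integrable_power_gaussian[OF assms, of 2]
  by (simp add: left_diff_distrib mult.assoc)

text \<open>Two integrations by parts: the first factor is the derivative of x exp(-a x^2), and x
  exp(-a x^2) is in turn a multiple of the derivative of the Gaussian. Each one contributes a factor
  \<open>w\<close>, and the second a factor \<open>1 / (2 * a)\<close>.\<close>

lemma integral_hermite_gaussian_cos:
  fixes a w :: real
  assumes a: "a > 0"
  shows "(\<integral>x. (1 - 2 * a * x\<^sup>2) * exp (- (a * x\<^sup>2)) * cos (w * x) \<partial>lborel)
    = w\<^sup>2 / (2 * a) * (sqrt (pi / a) * exp (- (w\<^sup>2 / (4 * a))))"
proof -
  let ?Q = "\<lambda>x. (1 - 2 * a * x\<^sup>2) * exp (- (a * x\<^sup>2)) * cos (w * x)"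
  let ?E = "\<lambda>x. exp (- (a * x\<^sup>2)) * cos (w * x)"
  \<comment> \<open>The boundary terms of both integrations by parts at once; in the derivative of
    \<open>?V\<close> the two terms with x exp(-a x^2) sin(w x) cancel.\<close>
  let ?V = "\<lambda>x. x * exp (- (a * x\<^sup>2)) * cos (w * x) - w / (2 * a) * (exp (- (a * x\<^sup>2)) * sin (w * x))"
  have iQ: "integrable lborel ?Q"
    by (rule integrable_mult_bounded[OF integrable_hermite_gaussian[OF a]]) auto
  have iE: "integrable lborel ?E"
    using integrable_power_gaussian[OF a, of 0] by (intro integrable_mult_bounded) auto
  have "(\<integral>x. ?Q x - w\<^sup>2 / (2 * a) * ?E x \<partial>lborel) = 0"
  proof (rule integral_lborel_derivative_eq_0[where F = ?V])
    show "(?V has_real_derivative ?Q x - w\<^sup>2 / (2 * a) * ?E x) (at x)" for x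
      using a by (auto intro!: derivative_eq_intros simp: field_simps power2_eq_square)
    show "integrable lborel (\<lambda>x. ?Q x - w\<^sup>2 / (2 * a) * ?E x)"
      using iQ iE by (intro Bochner_Integration.integrable_diff integrable_mult_right)
    have *: "(?V \<longlongrightarrow> 0 - w / (2 * a) * 0) F"
      if "((\<lambda>x. exp (- (a * x\<^sup>2))) \<longlongrightarrow> 0) F" "((\<lambda>x. x * exp (- (a * x\<^sup>2))) \<longlongrightarrow> 0) F" for F
      by (rule tendsto_diff[OF tendsto_0_mult_bounded[OF that(2)]
            tendsto_mult_left[OF tendsto_0_mult_bounded[OF that(1)]]]) auto
    show "(?V \<longlongrightarrow> 0) at_top" "(?V \<longlongrightarrow> 0) at_bot"
      using *[of at_top] *[of at_bot] gaussian_tendsto_0[OF a] by simp_all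
  qed (use a in \<open>auto intro!: continuous_intros\<close>)
  then have "integral\<^sup>L lborel ?Q = w\<^sup>2 / (2 * a) * integral\<^sup>L lborel ?E"
    using iQ iE by simp
  then show ?thesis by (simp only: integral_gaussian_cos[OF a])
qed

section \<open>The hyperbolic secant and its Fourier transform\<close>

text \<open>Supplies an integrable majorant for the hyperbolic secant, from the quadratic Taylor
  bound for \<open>exp\<close> and \<open>exp \<bar>x\<bar> \<le> 2 * cosh x\<close>.\<close>

lemma sech_le: "1 / cosh x \<le> 4 * inverse (1 + x\<^sup>2)" for x :: real
proof -
  have "1 + \<bar>x\<bar> + \<bar>x\<bar>\<^sup>2 / 2 \<le> exp \<bar>x\<bar>"
    by (rule exp_lower_Taylor_quadratic) simp
  also have "\<dots> \<le> 2 * cosh x"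
    by (auto simp: cosh_field_def abs_if)
  finally have "(1 + x\<^sup>2) / 4 \<le> cosh x"
    by simp
  then have "1 / cosh x \<le> 1 / ((1 + x\<^sup>2) / 4)"
    by (intro frac_le) (auto intro: add_pos_nonneg)
  then show ?thesis by (simp add: inverse_eq_divide)
qed

lemma integrable_sech: "integrable lborel (\<lambda>x::real. 1 / cosh x)"
proof (rule Bochner_Integration.integrable_bound)
  show "integrable lborel (\<lambda>x::real. 4 * inverse (1 + x\<^sup>2))"
    using integrable_inverse_1_plus_square by (simp add: set_integrable_def)
  have "continuous_on UNIV (\<lambda>x::real. 1 / cosh x)"
    by (intro continuous_intros) auto
  then show "(\<lambda>x::real. 1 / cosh x) \<in> borel_measurable lborel"
    by (simp add: borel_measurable_continuous_onI)
  show "AE x in lborel. norm (1 / cosh x) \<le> norm (4 * inverse (1 + x\<^sup>2 :: real))"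
    using sech_le by (auto simp: abs_of_nonneg)
qed

text \<open>Limit of \<open>sech_rectangle_bound\<close> as \<open>R\<close> tends to infinity; the
  sign condition on \<open>w\<close> comes from there.\<close>

lemma integral_cos_sech_nonneg:
  fixes w :: real
  assumes w: "0 \<le> w"
  shows "(\<integral>x. cos (w * x) / cosh x \<partial>lborel) = pi / cosh (pi * w / 2)"
proof -
  define f where "f = (\<lambda>x::real. exp (\<i> * w * x) / cosh (of_real x :: complex))"
  have f_eq: "f x = cis (w * x) / of_real (cosh x)" for x
    by (simp add: f_def cosh_complex_of_real cis_conv_exp mult.assoc)
  have nf: "norm (f x) = 1 / cosh x" for x
    by (simp add: f_eq norm_divide)
  have contf: "continuous_on A f" for A
    unfolding f_eq by (intro continuous_intros) auto
  have measf: "f \<in> borel_measurable borel"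
    by (intro borel_measurable_continuous_onI contf)
  have intf: "integrable lborel f"
    by (rule Bochner_Integration.integrable_bound[OF integrable_sech]) (auto simp: nf measf)
  \<comment> \<open>Dominated convergence with majorant \<open>1 / cosh x\<close>, the norm of
    \<open>f\<close>, identifies the limit of the truncated integrals.\<close>
  have "((\<lambda>R. \<integral>x. indicator {-R..R} x *\<^sub>R f x \<partial>lborel) \<longlongrightarrow> integral\<^sup>L lborel f) at_top"
  proof (rule integral_dominated_convergence_at_top[OF _ _ integrable_sech])
    show "AE x in lborel. ((\<lambda>R. indicator {-R..R} x *\<^sub>R f x) \<longlongrightarrow> f x) at_top"
    proof (rule AE_I2)
      fix x
      have "\<forall>\<^sub>F R in at_top. indicator {-R..R} x *\<^sub>R f x = f x"
        using eventually_ge_at_top[of "\<bar>x\<bar>"] by eventually_elim (auto simp: indicator_def)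
      then show "((\<lambda>R. indicator {-R..R} x *\<^sub>R f x) \<longlongrightarrow> f x) at_top"
        by (rule tendsto_eventually)
    qed
  qed (use measf in \<open>auto simp: indicator_def nf\<close>)
  moreover have "(\<integral>x. indicator {-R..R} x *\<^sub>R f x \<partial>lborel) = integral {-R..R} f" for R
    using set_borel_integral_eq_integral(2)[of "{-R..R}" f] borel_integrable_compact[of "{-R..R}" f] contf
    by (auto simp: set_integrable_def set_lebesgue_integral_def)
  ultimately have lim: "((\<lambda>R. integral {-R..R} f) \<longlongrightarrow> integral\<^sup>L lborel f) at_top"
    by simp
  have "((\<lambda>R. (1 + exp (- pi * w)) * integral {-R..R} f - 2 * pi * exp (- pi * w / 2)) \<longlongrightarrow> 0) at_top"
  proof (rule Lim_null_comparison)
    show "\<forall>\<^sub>F R in at_top. norm ((1 + exp (- pi * w)) * integral {-R..R} f - 2 * pi * exp (- pi * w / 2)) \<le> 2 * pi / sinh R"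
      using eventually_gt_at_top[of 0]
    proof eventually_elim
      case (elim R)
      show ?case unfolding f_def by (rule sech_rectangle_bound[OF w elim])
    qed
    show "((\<lambda>R::real. 2 * pi / sinh R) \<longlongrightarrow> 0) at_top"
      unfolding sinh_field_def by real_asymp
  qed
  moreover have "((\<lambda>R. (1 + exp (- pi * w)) * integral {-R..R} f - 2 * pi * exp (- pi * w / 2)) \<longlongrightarrow>
      (1 + exp (- pi * w)) * integral\<^sup>L lborel f - 2 * pi * exp (- pi * w / 2)) at_top"
    by (intro tendsto_intros lim)
  ultimately have "(1 + exp (- pi * w)) * integral\<^sup>L lborel f - 2 * pi * exp (- pi * w / 2) = 0"
    by (intro tendsto_unique[OF trivial_limit_at_top_linorder])
  then have "complex_of_real (1 + exp (- pi * w)) * integral\<^sup>L lborel f = of_real (2 * pi * exp (- pi * w / 2))"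
    by simp
  then have "(1 + exp (- pi * w)) * Re (integral\<^sup>L lborel f) = 2 * pi * exp (- pi * w / 2)"
    by (drule_tac arg_cong[where f = Re]) simp
  moreover have "Re (integral\<^sup>L lborel f) = (\<integral>x. cos (w * x) / cosh x \<partial>lborel)"
    using intf by (subst integral_Re[symmetric]) (auto simp: f_eq)
  \<comment> \<open>Exposes the factor \<open>exp (- pi * w / 2)\<close> shared with the residue
    term; cancelling it leaves the hyperbolic cosine.\<close>
  moreover have "1 + exp (- pi * w) = exp (- pi * w / 2) * (2 * cosh (pi * w / 2))"
  proof -
    have "exp (- pi * w / 2) * exp (pi * w / 2) = 1"
      "exp (- pi * w / 2) * exp (- pi * w / 2) = exp (- pi * w)"
      by (simp_all flip: exp_add)
    then show ?thesis by (simp add: cosh_field_def distrib_left)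
  qed
  ultimately have "exp (- pi * w / 2) * (2 * (cosh (pi * w / 2) * (\<integral>x. cos (w * x) / cosh x \<partial>lborel)))
      = exp (- pi * w / 2) * (2 * pi)"
    by (simp only: mult_ac)
  then have "cosh (pi * w / 2) * (\<integral>x. cos (w * x) / cosh x \<partial>lborel) = pi"
    by simp
  then show ?thesis by (simp add: eq_divide_eq mult.commute)
qed

lemma integral_cos_sech: "(\<integral>x. cos (w * x) / cosh x \<partial>lborel) = pi / cosh (pi * w / 2)" for w :: real
  \<comment> \<open>Both sides are even in \<open>w\<close>.\<close>
  using integral_cos_sech_nonneg[of w] integral_cos_sech_nonneg[of "- w"]
  by (cases "w \<ge> 0") auto

section \<open>Exchange of the Gaussian parameters \<open>a\<close> and \<open>b\<close> by Fubini's
  theorem\<close>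

lemma integrable_mult_sech:
  fixes f :: "real \<Rightarrow> real"
  assumes "integrable lborel f"
  shows "integrable lborel (\<lambda>x. f x / cosh x)"
proof -
  have "(\<lambda>x::real. 1 / cosh x) \<in> borel_measurable borel"
    using integrable_sech by (simp add: borel_measurable_integrable)
  moreover have "\<bar>1 / cosh x\<bar> \<le> 1" for x :: real
    using cosh_real_ge_1[of x] by (simp add: abs_of_nonneg)
  ultimately have "integrable lborel (\<lambda>x. f x * (1 / cosh x))"
    by (rule integrable_mult_bounded[OF assms])
  then show ?thesis by simp
qed

text \<open>A Parseval argument: \<open>1 / cosh y\<close> is written as its own cosine transform
  and the integrations are swapped. The inner integral is then the transform of the Gaussian factor,
  a multiple of 2 b x^2 exp(-b x^2), which is the difference of the two integrands on the
  right.\<close>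

lemma integral_hermite_gaussian_sech:
  fixes a b :: real
  assumes a: "a > 0" and b: "b = 1 / (pi\<^sup>2 * a)"
  shows "(\<integral>x. (1 - 2 * a * x\<^sup>2) * exp (- (a * x\<^sup>2)) / cosh x \<partial>lborel) =
     1 / sqrt (pi * a) * ((\<integral>x. exp (- (b * x\<^sup>2)) / cosh x \<partial>lborel)
        - (\<integral>x. (1 - 2 * b * x\<^sup>2) * exp (- (b * x\<^sup>2)) / cosh x \<partial>lborel))"
proof -
  have b0: "b > 0" using a by (simp add: b)
  define q where "q = (\<lambda>x. (1 - 2 * a * x\<^sup>2) * exp (- (a * x\<^sup>2)))"
  have q: "integrable lborel q"
    unfolding q_def by (rule integrable_hermite_gaussian[OF a])
  have [measurable]: "(\<lambda>x::real. 1 / cosh x) \<in> borel_measurable borel" "q \<in> borel_measurable borel"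
    using integrable_sech q by (simp_all add: borel_measurable_integrable)
  \<comment> \<open>The frequency \<open>2 / pi * y\<close> makes \<open>integral_cos_sech\<close>
    return exactly \<open>pi / cosh y\<close>.\<close>
  define g where "g = (\<lambda>x y. q y * cos (2 / pi * x * y) * (1 / cosh x))"
  \<comment> \<open>Since the cosine is bounded by 1, this product of integrable functions of one
    variable each dominates \<open>g\<close>.\<close>
  have "integrable (lborel \<Otimes>\<^sub>M lborel) (\<lambda>(x, y). (1 / cosh x) * q y)"
  proof (rule lborel_pair.Fubini_integrable)
    show "integrable lborel (\<lambda>x. \<integral>y. norm (case (x, y) of (x, y) \<Rightarrow> (1 / cosh x) * q y) \<partial>lborel)"
      using integrable_mult_left[OF integrable_sech, of "\<integral>y. \<bar>q y\<bar> \<partial>lborel"] by (simp add: abs_mult)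
    show "AE x in lborel. integrable lborel (\<lambda>y. case (x, y) of (x, y) \<Rightarrow> (1 / cosh x) * q y)"
      using q by simp
  qed measurable
  then have "integrable (lborel \<Otimes>\<^sub>M lborel) (case_prod g)"
  proof (rule Bochner_Integration.integrable_bound)
    show "case_prod g \<in> borel_measurable (lborel \<Otimes>\<^sub>M lborel)"
      unfolding g_def by measurable
    have "\<bar>g x y\<bar> \<le> \<bar>(1 / cosh x) * q y\<bar>" for x y
      unfolding g_def abs_mult by (simp add: mult_left_le divide_right_mono)
    then show "AE z in lborel \<Otimes>\<^sub>M lborel. norm (case_prod g z) \<le> norm (case z of (x, y) \<Rightarrow> (1 / cosh x) * q y)"
      by (auto simp: case_prod_beta)
  qed
  then have fub: "(\<integral>y. (\<integral>x. g x y \<partial>lborel) \<partial>lborel) = (\<integral>x. (\<integral>y. g x y \<partial>lborel) \<partial>lborel)"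
    by (rule lborel_pair.Fubini_integral)
  have left: "(\<integral>x. g x y \<partial>lborel) = pi * (q y / cosh y)" for y
  proof -
    have "(\<integral>x. g x y \<partial>lborel) = q y * (\<integral>x. cos (2 / pi * y * x) / cosh x \<partial>lborel)"
      unfolding g_def by (subst integral_mult_right_zero[symmetric]) (simp add: mult_ac)
    then show ?thesis by (simp only: integral_cos_sech) simp
  qed
  have right: "(\<integral>y. g x y \<partial>lborel) = pi / sqrt (pi * a) *
      (exp (- (b * x\<^sup>2)) / cosh x - (1 - 2 * b * x\<^sup>2) * exp (- (b * x\<^sup>2)) / cosh x)" for x
  proof -
    have "(\<integral>y. g x y \<partial>lborel) = (\<integral>y. q y * cos (2 / pi * x * y) \<partial>lborel) * (1 / cosh x)"
      unfolding g_def by (rule integral_mult_left_zero)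
    also have "\<dots> = (2 / pi * x)\<^sup>2 / (2 * a) * (sqrt (pi / a) * exp (- ((2 / pi * x)\<^sup>2 / (4 * a)))) * (1 / cosh x)"
      unfolding q_def by (simp only: integral_hermite_gaussian_cos[OF a])
    also have "(2 / pi * x)\<^sup>2 / (4 * a) = b * x\<^sup>2"
      using a by (simp add: b power2_eq_square field_simps)
    also have "(2 / pi * x)\<^sup>2 / (2 * a) = 2 * b * x\<^sup>2"
      using a by (simp add: b power2_eq_square field_simps)
    \<comment> \<open>This form shows the factor \<open>pi\<close> that also appears in
      \<open>left\<close> and will cancel.\<close>
    also have "sqrt (pi / a) = pi / sqrt (pi * a)"
      using a by (simp add: real_sqrt_divide real_sqrt_mult field_simps)
    finally show ?thesis by (simp add: field_simps)
  qed
  have i1: "integrable lborel (\<lambda>x. exp (- (b * x\<^sup>2)) / cosh x)"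
    using integrable_power_gaussian[OF b0, of 0] by (intro integrable_mult_sech) simp
  have i2: "integrable lborel (\<lambda>x. (1 - 2 * b * x\<^sup>2) * exp (- (b * x\<^sup>2)) / cosh x)"
    by (intro integrable_mult_sech integrable_hermite_gaussian b0)
  \<comment> \<open>For \<open>s = 0\<close> both quotients are 0 by convention, so \<open>u\<close>
    is 0 too.\<close>
  have cancel: "u = 1 / s * v" if "pi * u = pi / s * v" for u v s :: real
    using that by (cases "s = 0") (auto simp: field_simps)
  have "pi * (\<integral>y. q y / cosh y \<partial>lborel) = pi / sqrt (pi * a) * ((\<integral>x. exp (- (b * x\<^sup>2)) / cosh x \<partial>lborel)
        - (\<integral>x. (1 - 2 * b * x\<^sup>2) * exp (- (b * x\<^sup>2)) / cosh x \<partial>lborel))"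
    using fub unfolding left right integral_mult_right_zero Bochner_Integration.integral_diff[OF i1 i2] .
  then have "(\<integral>y. q y / cosh y \<partial>lborel) = 1 / sqrt (pi * a) * ((\<integral>x. exp (- (b * x\<^sup>2)) / cosh x \<partial>lborel)
        - (\<integral>x. (1 - 2 * b * x\<^sup>2) * exp (- (b * x\<^sup>2)) / cosh x \<partial>lborel))"
    by (rule cancel)
  then show ?thesis by (simp only: q_def)
qed

section \<open>Integration by parts for the left-hand integrand\<close>

text \<open>The quotient of \<open>sinh\<close> and squared \<open>cosh\<close> is
  \<open>- 1 / r\<close> times the derivative of \<open>1 / cosh (r * x)\<close>, so integration by
  parts moves the derivative to x exp(-c x^2). Substituting \<open>x / r\<close> gives the second
  factor \<open>1 / r\<close>.\<close>

lemma has_bochner_integral_moment_sinh_cosh: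
  fixes c r :: real
  assumes c: "c > 0" and r: "r > 0"
  shows "has_bochner_integral lborel (\<lambda>x. x * exp (- (c * x\<^sup>2)) * (sinh (r * x) / (cosh (r * x))\<^sup>2))
    (1 / r\<^sup>2 * (\<integral>x. (1 - 2 * (c / r\<^sup>2) * x\<^sup>2) * exp (- (c / r\<^sup>2 * x\<^sup>2)) / cosh x \<partial>lborel))"
proof -
  let ?h = "\<lambda>x. (1 - 2 * c * x\<^sup>2) * exp (- (c * x\<^sup>2)) / cosh (r * x)"
  let ?k = "\<lambda>x. x * exp (- (c * x\<^sup>2)) * (sinh (r * x) / (cosh (r * x))\<^sup>2)"
  let ?V = "\<lambda>x. x * exp (- (c * x\<^sup>2)) * (1 / cosh (r * x))"
  have meas: "(\<lambda>x::real. 1 / cosh (r * x)) \<in> borel_measurable borel"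
    "(\<lambda>x::real. sinh (r * x) / (cosh (r * x))\<^sup>2) \<in> borel_measurable borel"
    by (auto intro!: borel_measurable_continuous_onI continuous_intros)
  have sech1: "\<bar>1 / cosh y\<bar> \<le> 1" for y :: real
    using cosh_real_ge_1[of y] by (simp add: abs_of_nonneg)
  have "\<bar>sinh y\<bar> \<le> (cosh y)\<^sup>2" for y :: real
  proof -
    have "\<bar>sinh y\<bar> \<le> cosh y"
      by (rule power2_le_imp_le) (auto simp: cosh_square_eq)
    also have "\<dots> \<le> (cosh y)\<^sup>2"
      using cosh_real_ge_1[of y] by (simp add: power2_eq_square)
    finally show ?thesis .
  qed
  then have bnd: "\<bar>sinh y / (cosh y)\<^sup>2\<bar> \<le> 1" for y :: real
    by (simp add: abs_divide divide_le_eq_1)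
  have ih: "integrable lborel ?h"
    using integrable_mult_bounded[OF integrable_hermite_gaussian[OF c] meas(1) sech1] by simp
  have ik: "integrable lborel ?k"
    by (rule integrable_mult_bounded[OF _ meas(2) bnd]) (use integrable_power_gaussian[OF c, of 1] in simp)
  have "(\<integral>x. ?h x - r * ?k x \<partial>lborel) = 0"
  proof (rule integral_lborel_derivative_eq_0[where F = ?V])
    show "(?V has_real_derivative ?h x - r * ?k x) (at x)" for x
      by (auto intro!: derivative_eq_intros simp: field_simps power2_eq_square)
    show "integrable lborel (\<lambda>x. ?h x - r * ?k x)"
      using ih ik by (intro Bochner_Integration.integrable_diff integrable_mult_right)
    show "(?V \<longlongrightarrow> 0) at_top" "(?V \<longlongrightarrow> 0) at_bot"
      by (intro tendsto_0_mult_bounded gaussian_tendsto_0 c sech1)+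
  qed (auto intro!: continuous_intros)
  then have "integral\<^sup>L lborel ?h = r * integral\<^sup>L lborel ?k"
    by (simp only: Bochner_Integration.integral_diff[OF ih integrable_mult_right[OF ik]]
        integral_mult_right_zero right_minus_eq)
  moreover have "integral\<^sup>L lborel ?h = 1 / r * (\<integral>x. ?h (x / r) \<partial>lborel)"
    using lborel_integral_real_affine[of "1 / r" ?h 0] r by simp
  moreover have "?h (x / r) = (1 - 2 * (c / r\<^sup>2) * x\<^sup>2) * exp (- (c / r\<^sup>2 * x\<^sup>2)) / cosh x" for x
    using r by (simp add: power_divide)
  ultimately have "r * integral\<^sup>L lborel ?k
      = 1 / r * (\<integral>x. (1 - 2 * (c / r\<^sup>2) * x\<^sup>2) * exp (- (c / r\<^sup>2 * x\<^sup>2)) / cosh x \<partial>lborel)"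
    by (simp only:)
  moreover have "u = 1 / r\<^sup>2 * v" if "r * u = 1 / r * v" for u v
    using that r by (simp add: field_simps power2_eq_square)
  ultimately show ?thesis
    using ik unfolding has_bochner_integral_iff by blast
qed

section \<open>Passage to the half-line and assembly of the identity\<close>

lemma set_integral_even_function:
  fixes f :: "real \<Rightarrow> real"
  assumes f: "has_bochner_integral lborel f I" and even: "\<And>x. f (- x) = f x"
  shows "set_integrable lborel {0..} f" and "(LBINT x:{0..}. f x) = I / 2"
proof -
  have "set_integrable lborel UNIV f"
    using f by (simp add: set_integrable_def has_bochner_integral_iff)
  then show i: "set_integrable lborel {0..} f"
    by (rule set_integrable_subset) auto
  then have "has_bochner_integral lborel (\<lambda>x. indicator {0..} x *\<^sub>R f x) (LBINT x:{0..}. f x)"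
    by (simp add: set_integrable_def set_lebesgue_integral_def has_bochner_integral_iff)
  from has_bochner_integral_even_function[OF this even] f
  show "(LBINT x:{0..}. f x) = I / 2"
    using has_bochner_integral_eq by fastforce
qed

theorem mainTheorem13:
  fixes r :: real
  assumes "r > 0"
  shows "set_integrable lborel {0..}
           (\<lambda>x. x * (exp (- x\<^sup>2 / pi) + r * exp (- (r ^ 4 * x\<^sup>2) / pi)) * (sinh (r * x) / (cosh (r * x))\<^sup>2))
       \<and> set_integrable lborel {0..}
           (\<lambda>x. exp (- (r\<^sup>2 * x\<^sup>2) / pi) / cosh (r\<^sup>2 * x))
       \<and> (LBINT x:{0..}. x * (exp (- x\<^sup>2 / pi) + r * exp (- (r ^ 4 * x\<^sup>2) / pi)) * (sinh (r * x) / (cosh (r * x))\<^sup>2))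
         = (LBINT x:{0..}. exp (- (r\<^sup>2 * x\<^sup>2) / pi) / cosh (r\<^sup>2 * x))"
proof -
  define H K where "H = (\<lambda>a::real. \<integral>x. (1 - 2 * a * x\<^sup>2) * exp (- (a * x\<^sup>2)) / cosh x \<partial>lborel)"
    and "K = (\<lambda>a::real. \<integral>x. exp (- (a * x\<^sup>2)) / cosh x \<partial>lborel)"
  \<comment> \<open>The parameter \<open>c / r\<^sup>2\<close> of the first summand, where
    \<open>c = 1 / pi\<close>. It is also the dual 1 / (pi^2 a) of the second summand's parameter
    \<open>a = r\<^sup>2 / pi\<close>.\<close>
  define b where "b = 1 / (pi * r\<^sup>2)"
  have b: "b > 0" using assms by (simp add: b_def)
  let ?L = "\<lambda>x. x * (exp (- x\<^sup>2 / pi) + r * exp (- (r ^ 4 * x\<^sup>2) / pi)) * (sinh (r * x) / (cosh (r * x))\<^sup>2)"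
  let ?R = "\<lambda>x. exp (- (r\<^sup>2 * x\<^sup>2) / pi) / cosh (r\<^sup>2 * x)"
  have h1: "has_bochner_integral lborel (\<lambda>x. x * exp (- (1 / pi * x\<^sup>2)) * (sinh (r * x) / (cosh (r * x))\<^sup>2)) (1 / r\<^sup>2 * H b)"
    using has_bochner_integral_moment_sinh_cosh[of "1 / pi" r] assms by (simp add: H_def b_def)
  have h2: "has_bochner_integral lborel (\<lambda>x. x * exp (- (r ^ 4 / pi * x\<^sup>2)) * (sinh (r * x) / (cosh (r * x))\<^sup>2)) (1 / r\<^sup>2 * H (r\<^sup>2 / pi))"
  proof -
    have "r ^ 4 / pi / r\<^sup>2 = r\<^sup>2 / pi"
      using assms by (simp add: power2_eq_square power4_eq_xxxx)
    then show ?thesis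
      using has_bochner_integral_moment_sinh_cosh[of "r ^ 4 / pi" r] assms by (simp add: H_def)
  qed
  have "H (r\<^sup>2 / pi) = 1 / sqrt (pi * (r\<^sup>2 / pi)) * (K b - H b)"
    unfolding H_def K_def using assms
    by (intro integral_hermite_gaussian_sech) (auto simp: b_def power2_eq_square)
  \<comment> \<open>The square root is \<open>r\<close>, so the weight \<open>r\<close> of the
    second Gaussian cancels it, and \<open>H b\<close> will drop out of the sum.\<close>
  then have H: "r * H (r\<^sup>2 / pi) = K b - H b"
    using assms by simp
  have "has_bochner_integral lborel (\<lambda>x. x * exp (- (1 / pi * x\<^sup>2)) * (sinh (r * x) / (cosh (r * x))\<^sup>2)
     + r * (x * exp (- (r ^ 4 / pi * x\<^sup>2)) * (sinh (r * x) / (cosh (r * x))\<^sup>2))) (1 / r\<^sup>2 * H b + r * (1 / r\<^sup>2 * H (r\<^sup>2 / pi)))"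
    by (intro has_bochner_integral_add has_bochner_integral_mult_right h1 h2)
  also have "1 / r\<^sup>2 * H b + r * (1 / r\<^sup>2 * H (r\<^sup>2 / pi)) = 1 / r\<^sup>2 * (H b + r * H (r\<^sup>2 / pi))"
    by (simp add: algebra_simps)
  also have "H b + r * H (r\<^sup>2 / pi) = K b" using H by simp
  also have "(\<lambda>x. x * exp (- (1 / pi * x\<^sup>2)) * (sinh (r * x) / (cosh (r * x))\<^sup>2)
     + r * (x * exp (- (r ^ 4 / pi * x\<^sup>2)) * (sinh (r * x) / (cosh (r * x))\<^sup>2))) = ?L"
    by (simp add: fun_eq_iff algebra_simps)
  finally have L: "has_bochner_integral lborel ?L (1 / r\<^sup>2 * K b)" .
  have R: "has_bochner_integral lborel ?R (1 / r\<^sup>2 * K b)"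
  proof -
    have "integrable lborel (\<lambda>x. exp (- (b * x\<^sup>2)) / cosh x)"
      using integrable_power_gaussian[OF b, of 0] by (intro integrable_mult_sech) simp
    then have "has_bochner_integral lborel (\<lambda>x. exp (- (b * x\<^sup>2)) / cosh x) (K b)"
      by (simp add: has_bochner_integral_iff K_def)
    \<comment> \<open>The substitution of \<open>r\<^sup>2 * x\<close> for the variable in
      \<open>K b\<close> produces \<open>?R\<close>, with the factor
      \<open>1 / r\<^sup>2\<close>.\<close>
    moreover have "b * (r\<^sup>2 * x)\<^sup>2 = r\<^sup>2 * x\<^sup>2 / pi" for x
      using assms by (simp add: b_def power2_eq_square)
    ultimately show ?thesis
      using assms lborel_has_bochner_integral_real_affine_iff[of "r\<^sup>2" "\<lambda>x. exp (- (b * x\<^sup>2)) / cosh x" "K b" 0]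
      by (simp add: divide_inverse mult.commute)
  qed
  show ?thesis
    using set_integral_even_function[OF L] set_integral_even_function[OF R] by simp
qed

end
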